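(* Let $H$ be a finite hypergraph and let $G$ be a finite graph. (1) If $\tau(G)\ge 2$, then $\overrightarrow{\tau}(G)\le 2\,\tau(G)\log_2 \tau(G)$. (2) If $\tau(H)\ge 2$, then $\overrightarrow{\tau}(H) < \tau(H)\log_2 |E(H)| \le r(H)\,\tau(H)\log_2 |V(H)|$.
   Context: A hypergraph $H$ consists of a finite vertex set $V(H)$ and a set $E(H)$ of hyperedges, each a nonempty subset of $V(H)$ (no repeated hyperedges). Its rank $r(H)$ is the maximum cardinality of a hyperedge. A graph is a hypergraph all of whose hyperedges have exactly two vertices. A set cover of $H$ is a set of vertices intersecting every hyperedge; $\tau(H)$ is the minimum size of a set cover. For a bijection $\sigma: V(H)\to\{1,\dots,|V(H)|\}$ (an ordering), its cost is $\sum_{e\in E(H)}\min_{v\in e}\sigma(v)$. A minimum sum set cover of $H$ is an ordering of minimum cost. For an ordering $\sigma$, let $S_\sigma$ be the set of vertices $v$ with $\sigma(v)\le \max_{e\in E(H)}\min_{u\in e}\sigma(u)$ (the set cover determined by $\sigma$). Define $\overrightarrow{\tau}(H)=\max\{|S_\sigma| : \sigma \text{ a minimum sum set cover of } H\}$.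
   Formalization: In (2) the strict inequality is claimed only when |E(H)| ≠ 2; when |E(H)| = 2 only ≤ is claimed, since two disjoint hyperedges give equality (both sides equal 2), so the strict bound is false there. *)

theory Defs
  imports Complex_Main
begin

definition hypergraph :: "'a set \<Rightarrow> 'a set set \<Rightarrow> bool" where
  "hypergraph V E \<longleftrightarrow> finite V \<and> (\<forall>e\<in>E. e \<noteq> {} \<and> e \<subseteq> V)"

definition simple_graph :: "'a set \<Rightarrow> 'a set set \<Rightarrow> bool" where
  "simple_graph V E \<longleftrightarrow> hypergraph V E \<and> (\<forall>e\<in>E. card e = 2)"

(* Max of the empty set is unspecified: the rank, and below the last covering time, are
   meaningful only for hypergraphs with at least one hyperedge. *)
definition hrank :: "'a set set \<Rightarrow> nat" where
  "hrank E = Max (card ` E)"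

definition set_cover :: "'a set \<Rightarrow> 'a set set \<Rightarrow> 'a set \<Rightarrow> bool" where
  "set_cover V E C \<longleftrightarrow> C \<subseteq> V \<and> (\<forall>e\<in>E. C \<inter> e \<noteq> {})"

definition cover_number :: "'a set \<Rightarrow> 'a set set \<Rightarrow> nat" where
  "cover_number V E = Min (card ` {C. set_cover V E C})"

(* Values of an ordering outside V are irrelevant. *)
definition ordering_of :: "'a set \<Rightarrow> ('a \<Rightarrow> nat) \<Rightarrow> bool" where
  "ordering_of V \<sigma> \<longleftrightarrow> bij_betw \<sigma> V {1..card V}"

definition cover_time :: "('a \<Rightarrow> nat) \<Rightarrow> 'a set \<Rightarrow> nat" where
  "cover_time \<sigma> e = Min (\<sigma> ` e)"

definition ordering_cost :: "'a set set \<Rightarrow> ('a \<Rightarrow> nat) \<Rightarrow> nat" where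
  "ordering_cost E \<sigma> = (\<Sum>e\<in>E. cover_time \<sigma> e)"

definition min_sum_set_cover :: "'a set \<Rightarrow> 'a set set \<Rightarrow> ('a \<Rightarrow> nat) \<Rightarrow> bool" where
  "min_sum_set_cover V E \<sigma> \<longleftrightarrow> is_arg_min (ordering_cost E) (ordering_of V) \<sigma>"

definition induced_cover :: "'a set \<Rightarrow> 'a set set \<Rightarrow> ('a \<Rightarrow> nat) \<Rightarrow> 'a set" where
  "induced_cover V E \<sigma> = {v \<in> V. \<sigma> v \<le> Max (cover_time \<sigma> ` E)}"

definition mssc_number :: "'a set \<Rightarrow> 'a set set \<Rightarrow> nat" where
  "mssc_number V E = Max {card (induced_cover V E \<sigma>) |\<sigma>. min_sum_set_cover V E \<sigma>}"

(* Two disjoint hyperedges: mssc_number = cover_number * log 2 (card E), so the strict bound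
   mssc_number < cover_number * log 2 (card E) cannot hold for all hypergraphs with
   cover_number >= 2. *)
lemma two_disjoint_hyperedges:
  defines "V \<equiv> {0, 1 :: nat}" and "E \<equiv> {{0}, {1 :: nat}}"
  shows "hypergraph V E" and "cover_number V E = 2" and "mssc_number V E = 2"
    and "real (mssc_number V E) = real (cover_number V E) * log 2 (real (card E))"
proof -
  show "hypergraph V E"
    by (auto simp: hypergraph_def V_def E_def)
  have "{C. set_cover V E C} = {{0, 1}}"
    by (auto simp: set_cover_def V_def E_def)
  then show cov: "cover_number V E = 2"
    by (simp add: cover_number_def)
  have cardV: "card V = 2" and cardE: "card E = 2"
    by (simp_all add: V_def E_def)
  have range2: "{1..2::nat} = {1, 2}"
    by auto
  have ord: "(\<sigma> 0 = 1 \<and> \<sigma> 1 = 2) \<or> (\<sigma> 0 = 2 \<and> \<sigma> 1 = 1)" if "ordering_of V \<sigma>" for \<sigma>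
    using that unfolding ordering_of_def bij_betw_def cardV range2
    by (auto simp: V_def doubleton_eq_iff)
  have cost: "ordering_cost E \<sigma> = \<sigma> 0 + \<sigma> 1" for \<sigma>
    by (simp add: ordering_cost_def cover_time_def E_def)
  have cost3: "ordering_cost E \<sigma> = 3" if "ordering_of V \<sigma>" for \<sigma>
    using ord[OF that] cost[of \<sigma>] by auto
  have card2: "card (induced_cover V E \<sigma>) = 2" if "ordering_of V \<sigma>" for \<sigma>
  proof -
    have "induced_cover V E \<sigma> = V"
      using ord[OF that] by (auto simp: induced_cover_def cover_time_def V_def E_def)
    then show ?thesis using cardV by simp
  qed
  have "ordering_of V Suc"
    unfolding ordering_of_def bij_betw_def cardV range2 by (auto simp: V_def)
  moreover have "min_sum_set_cover V E \<sigma> \<longleftrightarrow> ordering_of V \<sigma>" for \<sigma>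
    using cost3 by (auto simp: min_sum_set_cover_def is_arg_min_def)
  ultimately have "{card (induced_cover V E \<sigma>) |\<sigma>. min_sum_set_cover V E \<sigma>} = {2}"
    using card2 by force
  then show mssc: "mssc_number V E = 2"
    by (simp add: mssc_number_def)
  show "real (mssc_number V E) = real (cover_number V E) * log 2 (real (card E))"
    by (simp add: mssc cov cardE)
qed

end

theory Submission
  imports Defs
begin

text \<open>
  Let \<open>a j\<close> be the number of hyperedges first met at time \<open>j\<close> and \<open>m i\<close> the number of those not met
  by time \<open>i\<close>. Exchanging two consecutive vertices of an optimal ordering shows that \<open>a\<close> is
  nonincreasing. If \<open>d\<close> vertices cover all hyperedges not met by time \<open>i\<close>, one may visit them from time
  \<open>i + 1\<close> on, either in some order or in the reverse one; averaging the two costs bounds the mean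
  residual waiting time by \<open>(d + 1) / 2\<close>. Together with the monotonicity of \<open>a\<close> this gives
  \<open>m i \<le> d * a (i + 1)\<close>, so \<open>m\<close> decays geometrically with ratio \<open>1 - 1 / d\<close>. For a graph with
  a minimum cover \<open>C\<close>, a vertex outside \<open>C\<close> has at most as many uncovered edges as there are unvisited
  vertices of \<open>C\<close>. Hence the ordering starts inside \<open>C\<close> until, with \<open>u\<close> vertices of \<open>C\<close> left,
  \<open>a\<close> drops to at most \<open>u\<close>; then at most \<open>u ^ 2\<close> edges remain.
\<close>

section \<open>Elementary bounds on covers and on the number of hyperedges\<close>

lemma hypergraph_finite: "hypergraph V E \<Longrightarrow> finite E"
  unfolding hypergraph_def by (meson finite_Pow_iff finite_subset Pow_iff subsetI)

lemma min_cover_exists: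
  assumes "hypergraph V E"
  obtains C where "set_cover V E C" "card C = cover_number V E"
proof -
  have fin: "finite {C. set_cover V E C}"
    by (rule finite_subset[of _ "Pow V"]) (use assms in \<open>auto simp: set_cover_def hypergraph_def\<close>)
  have "set_cover V E V"
    using assms by (auto simp: set_cover_def hypergraph_def)
  then have "cover_number V E \<in> card ` {C. set_cover V E C}"
    unfolding cover_number_def using fin by (intro Min_in) auto
  then show ?thesis using that by auto
qed

lemma cover_number_le:
  assumes "hypergraph V E" "set_cover V E C"
  shows "cover_number V E \<le> card C"
proof -
  have fin: "finite {C. set_cover V E C}"
    by (rule finite_subset[of _ "Pow V"]) (use assms in \<open>auto simp: set_cover_def hypergraph_def\<close>)
  then show ?thesis
    unfolding cover_number_def using assms by (intro Min_le) auto
qed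

text \<open>One vertex picked from each hyperedge already forms a cover. Later this turns
  \<open>2 \<le> cover_number V E\<close> into \<open>E \<noteq> {}\<close> and
  \<open>2 \<le> card E\<close>.\<close>

lemma cover_number_le_card:
  assumes "hypergraph V E"
  shows "cover_number V E \<le> card E"
proof -
  have "\<forall>e\<in>E. \<exists>v. v \<in> e" using assms by (auto simp: hypergraph_def)
  then obtain f where f: "\<forall>e\<in>E. f e \<in> e" by metis
  have "set_cover V E (f ` E)"
    using f assms by (auto simp: set_cover_def hypergraph_def)
  then have "cover_number V E \<le> card (f ` E)" using assms cover_number_le by blast
  also have "\<dots> \<le> card E" using hypergraph_finite[OF assms] by (rule card_image_le)
  finally show ?thesis .
qed

text \<open>A list enumerating a hyperedge can be padded to length exactly \<open>hrank E\<close> by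
  repeating one of its elements, so the lists of that length already produce every hyperedge as
  their set.\<close>

lemma card_le_power_hrank:
  assumes "hypergraph V E"
  shows "card E \<le> card V ^ hrank E"
proof -
  let ?L = "{xs. set xs \<subseteq> V \<and> length xs = hrank E}"
  have finV: "finite V" using assms by (simp add: hypergraph_def)
  have "E \<subseteq> set ` ?L"
  proof
    fix e assume e: "e \<in> E"
    then have "finite e" "e \<noteq> {}" "e \<subseteq> V"
      using assms finite_subset by (auto simp: hypergraph_def)
    then obtain xs where xs: "set xs = e" "distinct xs" using finite_distinct_list by blast
    obtain x where x: "x \<in> e" using \<open>e \<noteq> {}\<close> by blast
    have "length xs = card e" using xs distinct_card by metis
    also have "\<dots> \<le> hrank E"
      unfolding hrank_def using hypergraph_finite[OF assms] e by (intro Max_ge) auto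
    finally have "length (xs @ replicate (hrank E - length xs) x) = hrank E" by simp
    moreover have "set (xs @ replicate (hrank E - length xs) x) = e" using xs x by auto
    ultimately show "e \<in> set ` ?L" using \<open>e \<subseteq> V\<close> by (metis (mono_tags, lifting) imageI mem_Collect_eq)
  qed
  then have "card E \<le> card (set ` ?L)"
    using finite_lists_length_eq[OF finV] by (intro card_mono) auto
  also have "\<dots> \<le> card ?L" using finite_lists_length_eq[OF finV] by (intro card_image_le)
  also have "\<dots> = card V ^ hrank E" by (rule card_lists_length_eq[OF finV])
  finally show ?thesis .
qed

section \<open>Orderings obtained from injective priorities\<close>

text \<open>Ranking vertices by priority closes all gaps. The rank of \<open>v\<close> is at most
  \<open>p v\<close>, because \<open>p\<close> injects the vertices ranked up to \<open>v\<close>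
  into \<open>{1..p v}\<close>. Competitors to an optimal ordering may therefore be given with
  gaps.\<close>

lemma ordering_below_priority:
  fixes p :: "'a \<Rightarrow> nat"
  assumes "finite V" "inj_on p V" "\<And>v. v \<in> V \<Longrightarrow> 1 \<le> p v"
  obtains \<pi> where "ordering_of V \<pi>" "\<And>v. v \<in> V \<Longrightarrow> \<pi> v \<le> p v"
proof
  let ?\<pi> = "\<lambda>v. card {u \<in> V. p u \<le> p v}"
  have less: "?\<pi> u < ?\<pi> v" if "u \<in> V" "v \<in> V" "p u < p v" for u v
  proof (rule psubset_card_mono)
    have "v \<in> {u \<in> V. p u \<le> p v}" "v \<notin> {w \<in> V. p w \<le> p u}" using that by auto
    moreover have "{w \<in> V. p w \<le> p u} \<subseteq> {u \<in> V. p u \<le> p v}" using that by auto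
    ultimately show "{w \<in> V. p w \<le> p u} \<subset> {u \<in> V. p u \<le> p v}" by blast
  qed (use assms(1) in simp)
  have inj: "inj_on ?\<pi> V"
  proof (rule inj_onI)
    fix u v assume uv: "u \<in> V" "v \<in> V" "?\<pi> u = ?\<pi> v"
    then have "p u = p v" using less[of u v] less[of v u] by (cases "p u" "p v" rule: linorder_cases) auto
    then show "u = v" using assms(2) uv by (auto dest: inj_onD)
  qed
  have "?\<pi> v \<in> {1..card V}" if "v \<in> V" for v
  proof -
    have "{u \<in> V. p u \<le> p v} \<noteq> {}" using that by auto
    then have "0 < ?\<pi> v" using assms(1) by (simp add: card_gt_0_iff)
    moreover have "?\<pi> v \<le> card V" using assms(1) by (intro card_mono) auto
    ultimately show ?thesis by simp
  qed
  then have "?\<pi> ` V = {1..card V}"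
    using inj by (intro card_subset_eq) (auto simp: card_image)
  then show "ordering_of V ?\<pi>" using inj by (simp add: ordering_of_def bij_betw_def)
  fix v assume v: "v \<in> V"
  have "?\<pi> v = card (p ` {u \<in> V. p u \<le> p v})"
    using assms(2) by (intro card_image[symmetric]) (auto intro: inj_on_subset)
  also have "\<dots> \<le> card {1..p v}" using assms(3) by (intro card_mono) auto
  finally show "?\<pi> v \<le> p v" by simp
qed

lemma min_sum_set_cover_exists:
  assumes "hypergraph V E"
  obtains \<sigma> where "min_sum_set_cover V E \<sigma>"
proof -
  have fin: "finite V" using assms by (simp add: hypergraph_def)
  then obtain f :: "'a \<Rightarrow> nat" where "inj_on f V" using finite_imp_inj_to_nat_seg by blast
  then have "inj_on (Suc \<circ> f) V" by (simp add: inj_on_def)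
  then obtain \<pi> where "ordering_of V \<pi>" using ordering_below_priority[OF fin, of "Suc \<circ> f"] by auto
  then obtain \<sigma> where "ordering_of V \<sigma>" "\<forall>\<pi>. ordering_of V \<pi> \<longrightarrow> ordering_cost E \<sigma> \<le> ordering_cost E \<pi>"
    using ex_has_least_nat[of "ordering_of V" \<pi> "ordering_cost E"] by auto
  then have "min_sum_set_cover V E \<sigma>"
    by (auto simp: min_sum_set_cover_def is_arg_min_def not_less)
  then show ?thesis by (rule that)
qed

section \<open>Counting hyperedges along a fixed optimal ordering\<close>

locale optimal_ordering =
  fixes V :: "'a set" and E :: "'a set set" and \<sigma> :: "'a \<Rightarrow> nat"
  assumes hyp: "hypergraph V E" and opt: "min_sum_set_cover V E \<sigma>"
begin

abbreviation T :: "'a set \<Rightarrow> nat" where "T \<equiv> cover_time \<sigma>"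

definition new_at :: "nat \<Rightarrow> nat" where "new_at j = card {e \<in> E. T e = j}"

definition uncovered :: "nat \<Rightarrow> nat" where "uncovered i = card {e \<in> E. i < T e}"

text \<open>Truncated subtraction is intended: hyperedges met by time \<open>i\<close> contribute
  zero.\<close>

definition residual_cost :: "nat \<Rightarrow> nat" where "residual_cost i = (\<Sum>e\<in>E. T e - i)"

definition last_time :: nat where "last_time = Max (T ` E)"

lemma finV: "finite V" and finE: "finite E"
  using hyp hypergraph_finite by (auto simp: hypergraph_def)

lemma bij: "bij_betw \<sigma> V {1..card V}"
  using opt by (simp add: min_sum_set_cover_def is_arg_min_def ordering_of_def)

lemma \<sigma>_inj: "u \<in> V \<Longrightarrow> v \<in> V \<Longrightarrow> \<sigma> u = \<sigma> v \<Longrightarrow> u = v"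
  using bij by (auto simp: bij_betw_def dest: inj_onD)

lemma \<sigma>_pos: "v \<in> V \<Longrightarrow> 1 \<le> \<sigma> v"
  using bij bij_betwE by fastforce

lemma edgeD:
  assumes "e \<in> E"
  shows "finite e" "e \<noteq> {}" "e \<subseteq> V"
  using assms hyp finite_subset by (auto simp: hypergraph_def)

lemma cover_time_le: "e \<in> E \<Longrightarrow> v \<in> e \<Longrightarrow> cover_time p e \<le> p v"
  using edgeD by (simp add: cover_time_def)

lemma cover_time_attained:
  assumes "e \<in> E"
  obtains v where "v \<in> e" "v \<in> V" "\<sigma> v = T e"
proof -
  have "T e \<in> \<sigma> ` e" unfolding cover_time_def using edgeD[OF assms] by (intro Min_in) auto
  then obtain v where "v \<in> e" "\<sigma> v = T e" by auto
  then show ?thesis using that edgeD(3)[OF assms] by blast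
qed

lemma cover_time_bounds:
  assumes "e \<in> E"
  shows "1 \<le> T e" "T e \<le> card V"
proof -
  obtain v where "v \<in> V" "\<sigma> v = T e" using assms by (rule cover_time_attained)
  then have "T e \<in> {1..card V}" using bij by (metis bij_betwE)
  then show "1 \<le> T e" "T e \<le> card V" by auto
qed

text \<open>Compressing \<open>p\<close> to an ordering lowers no vertex's rank above its priority,
  hence no cover time increases, and optimality applies to the compressed ordering.\<close>

lemma cost_le_priority:
  assumes "inj_on p V" "\<And>v. v \<in> V \<Longrightarrow> 1 \<le> p v"
  shows "(\<Sum>e\<in>E. T e) \<le> (\<Sum>e\<in>E. cover_time p e)"
proof -
  obtain \<pi> where \<pi>: "ordering_of V \<pi>" "\<And>v. v \<in> V \<Longrightarrow> \<pi> v \<le> p v"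
    using ordering_below_priority[OF finV assms] by blast
  have "(\<Sum>e\<in>E. T e) \<le> (\<Sum>e\<in>E. cover_time \<pi> e)"
    using opt \<pi>(1) by (auto simp: min_sum_set_cover_def is_arg_min_def ordering_cost_def not_less)
  also have "\<dots> \<le> (\<Sum>e\<in>E. cover_time p e)"
  proof (rule sum_mono)
    fix e assume e: "e \<in> E"
    have "cover_time p e \<in> p ` e"
      unfolding cover_time_def using edgeD[OF e] by (intro Min_in) auto
    then obtain v where v: "v \<in> e" "cover_time p e = p v" by auto
    have "cover_time \<pi> e \<le> \<pi> v" using cover_time_le[OF e v(1)] .
    also have "\<dots> \<le> p v" using \<pi>(2) v(1) edgeD[OF e] by auto
    finally show "cover_time \<pi> e \<le> cover_time p e" using v by simp
  qed
  finally show ?thesis .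
qed

section \<open>Consequences of exchanging consecutive vertices\<close>

text \<open>Swapping times \<open>j\<close> and \<open>Suc j\<close> gains one unit on every
  hyperedge first met at \<open>Suc j\<close> and loses at most one on every hyperedge first met at
  \<open>j\<close>. For \<open>j = card V\<close> the swap leaves a gap, which priorities
  permit.\<close>

lemma new_at_Suc_le:
  assumes "1 \<le> j"
  shows "new_at (Suc j) \<le> new_at j"
proof -
  define s where "s x = (if x = j then Suc j else if x = Suc j then j else x)" for x
  have "inj s" by (auto simp: inj_on_def s_def split: if_splits)
  then have inj: "inj_on (s \<circ> \<sigma>) V"
    using bij by (auto simp: bij_betw_def intro: comp_inj_on inj_on_subset)
  have pos: "1 \<le> (s \<circ> \<sigma>) v" if "v \<in> V" for v using assms \<sigma>_pos[OF that] by (auto simp: s_def)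
  have "(\<Sum>e\<in>E. T e) \<le> (\<Sum>e\<in>E. cover_time (s \<circ> \<sigma>) e)"
    by (rule cost_le_priority[OF inj pos])
  also have "\<dots> \<le> (\<Sum>e\<in>E. s (T e))"
  proof (rule sum_mono)
    fix e assume e: "e \<in> E"
    then obtain v where "v \<in> e" "\<sigma> v = T e" by (rule cover_time_attained)
    then show "cover_time (s \<circ> \<sigma>) e \<le> s (T e)" using cover_time_le[OF e, of v "s \<circ> \<sigma>"] by simp
  qed
  \<comment> \<open>Adding \<open>new_at (Suc j)\<close> to both sides expresses the change of cost
    without subtraction on naturals.\<close>
  finally have "(\<Sum>e\<in>E. T e) + new_at (Suc j) \<le> (\<Sum>e\<in>E. s (T e)) + new_at (Suc j)" by simp
  also have "\<dots> = (\<Sum>e\<in>E. T e) + new_at j"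
  proof -
    have new: "new_at i = (\<Sum>e\<in>E. if T e = i then 1 else 0)" for i
      unfolding new_at_def using finE by (simp add: sum.If_cases Int_def)
    show ?thesis
      unfolding new sum.distrib[symmetric] by (rule sum.cong) (auto simp: s_def)
  qed
  finally show ?thesis by simp
qed

lemma new_at_antimono:
  assumes "1 \<le> i" "i \<le> j"
  shows "new_at j \<le> new_at i"
  using assms(2)
proof (induction j rule: dec_induct)
  case (step n)
  then show ?case using new_at_Suc_le[of n] assms(1) by linarith
qed simp

lemma uncovered_rec: "uncovered i = new_at (Suc i) + uncovered (Suc i)"
proof -
  have "{e \<in> E. i < T e} = {e \<in> E. T e = Suc i} \<union> {e \<in> E. Suc i < T e}" by auto
  then show ?thesis
    unfolding uncovered_def new_at_def using finE by (simp add: card_Un_disjoint disjoint_iff)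
qed

lemma residual_cost_rec: "residual_cost i = uncovered i + residual_cost (Suc i)"
proof -
  have "uncovered i = (\<Sum>e\<in>E. if i < T e then 1 else 0)"
    unfolding uncovered_def using finE by (simp add: sum.If_cases Int_def)
  then show ?thesis
    unfolding residual_cost_def by (simp flip: sum.distrib) (rule sum.cong, auto)
qed

text \<open>Twice the residual cost minus \<open>uncovered i\<close> is the relevant factor; the subtraction is avoided by
  moving a term to the left.\<close>

lemma uncovered_square_le:
  "uncovered i * uncovered i + new_at (Suc i) * uncovered i \<le> 2 * new_at (Suc i) * residual_cost i"
proof (cases "i \<le> card V")
  case True
  then show ?thesis
  \<comment> \<open>The induction runs downwards from \<open>card V\<close>, where nothing is left
    uncovered.\<close>
  proof (induction i rule: inc_induct)
    case base
    have "{e \<in> E. card V < T e} = {}" using cover_time_bounds(2) by fastforce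
    then have "uncovered (card V) = 0" unfolding uncovered_def by (metis card.empty)
    then show ?case by simp
  next
    case (step i)
    define a b m W where "a = new_at (Suc i)" and "b = new_at (Suc (Suc i))"
      and "m = uncovered (Suc i)" and "W = residual_cost (Suc i)"
    have IH: "m * m + b * m \<le> 2 * b * W" using step.IH by (simp add: b_def m_def W_def)
    have ba: "b \<le> a" unfolding a_def b_def by (rule new_at_Suc_le) simp
    have mW: "m \<le> W" unfolding m_def W_def by (subst residual_cost_rec) simp
    obtain c where c: "a = b + c" using ba le_Suc_ex by blast
    \<comment> \<open>Replacing \<open>b\<close> by \<open>a = b + c\<close> adds
      \<open>c * m\<close> on the left and \<open>2 * c * W\<close> on the right, which is harmless
      since \<open>m \<le> W\<close>. Substituting the recurrences at \<open>i\<close> reduces the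
      goal to this inequality.\<close>
    have "m * m + a * m \<le> 2 * a * W"
    proof -
      have "c * m \<le> c * W" using mW by simp
      moreover have "c * W \<le> 2 * c * W" by simp
      ultimately show ?thesis using IH unfolding c by (simp only: distrib_right distrib_left)
    qed
    moreover have "uncovered i = a + m" "residual_cost i = a + m + W"
      using uncovered_rec[of i] residual_cost_rec[of i] by (simp_all add: a_def m_def W_def)
    ultimately show ?case unfolding a_def[symmetric] by (simp add: algebra_simps)
  qed
next
  case False
  then have "{e \<in> E. i < T e} = {}" using cover_time_bounds(2) by fastforce
  then have "uncovered i = 0" unfolding uncovered_def by (metis card.empty)
  then show ?thesis by simp
qed

section \<open>Averaging over two opposite visits of a cover\<close>

lemma residual_cost_le:
  assumes D: "D \<subseteq> V" and cov: "\<And>e. e \<in> E \<Longrightarrow> i < T e \<Longrightarrow> D \<inter> e \<noteq> {}"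
  shows "2 * residual_cost i \<le> (card D + 1) * uncovered i"
proof -
  define d where "d = card D"
  have finD: "finite D" using D finV finite_subset by blast
  have "card D = card {1..d}" by (simp add: d_def)
  then obtain g where g: "bij_betw g D {1..d}"
    using finite_same_card_bij[OF finD finite_atLeastAtMost] by blast
  have gb: "1 \<le> g v" "g v \<le> d" if "v \<in> D" for v
    using bij_betwE[OF g] that by auto
  have ginj: "u = v" if "u \<in> D" "v \<in> D" "g u = g v" for u v
    using g that by (auto simp: bij_betw_def dest: inj_onD)
  \<comment> \<open>Times up to \<open>i\<close> are kept, the unvisited part of \<open>D\<close>
    gets times in \<open>i + 1\<close> to \<open>i + d\<close>, and everything else is pushed beyond
    \<open>i + d\<close>. Gaps are harmless.\<close>
  define p where "p h v = (if \<sigma> v \<le> i then \<sigma> v else if v \<in> D then i + h v else i + d + \<sigma> v)"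
    for h :: "'a \<Rightarrow> nat" and v
  \<comment> \<open>The reverse of \<open>g\<close>: the two positions of each vertex of
    \<open>D\<close> sum to \<open>d + 1\<close>.\<close>
  define g' where "g' v = d + 1 - g v" for v
  have g'b: "1 \<le> g' v" "g' v \<le> d" if "v \<in> D" for v using gb[OF that] by (auto simp: g'_def)
  have g'inj: "u = v" if "u \<in> D" "v \<in> D" "g' u = g' v" for u v
    using that gb[of u] gb[of v] ginj[of u v] by (auto simp: g'_def)
  have le: "(\<Sum>e\<in>E. T e) \<le> (\<Sum>e\<in>E. cover_time (p h) e)"
    if hb: "\<And>v. v \<in> D \<Longrightarrow> 1 \<le> h v \<and> h v \<le> d"
      and hinj: "\<And>u v. u \<in> D \<Longrightarrow> v \<in> D \<Longrightarrow> h u = h v \<Longrightarrow> u = v" for h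
  proof (rule cost_le_priority)
    show "inj_on (p h) V"
    proof (rule inj_onI)
      fix u v assume uv: "u \<in> V" "v \<in> V" "p h u = p h v"
      show "u = v"
        using uv hb[of u] hb[of v] hinj[of u v] \<sigma>_inj[of u v]
        by (auto simp: p_def split: if_splits)
    qed
    show "1 \<le> p h v" if "v \<in> V" for v
      using \<sigma>_pos[OF that] hb[of v] by (auto simp: p_def)
  qed
  have "2 * (\<Sum>e\<in>E. T e) \<le> (\<Sum>e\<in>E. cover_time (p g) e + cover_time (p g') e)"
    using le[of g] le[of g'] gb ginj g'b g'inj by (simp add: sum.distrib)
  also have "\<dots> \<le> (\<Sum>e\<in>E. if i < T e then 2 * i + d + 1 else 2 * T e)"
  proof (rule sum_mono)
    fix e assume e: "e \<in> E"
    show "cover_time (p g) e + cover_time (p g') e \<le> (if i < T e then 2 * i + d + 1 else 2 * T e)"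
    proof (cases "i < T e")
      case True
      then obtain v where v: "v \<in> D" "v \<in> e" using cov[OF e] by auto
      then have "i < \<sigma> v" using cover_time_le[OF e v(2), of \<sigma>] True by simp
      \<comment> \<open>A single vertex of \<open>D\<close> in \<open>e\<close> bounds both cover
        times, so its two positions may be added.\<close>
      then have "p g v + p g' v = 2 * i + d + 1" using v gb[OF v(1)] by (simp add: p_def g'_def)
      then show ?thesis
        using True cover_time_le[OF e v(2), of "p g"] cover_time_le[OF e v(2), of "p g'"] by simp
    next
      case False
      obtain v where v: "v \<in> e" "\<sigma> v = T e" using e by (rule cover_time_attained)
      then have "p g v = T e" "p g' v = T e" using False by (simp_all add: p_def)
      then show ?thesis
        using False cover_time_le[OF e v(1), of "p g"] cover_time_le[OF e v(1), of "p g'"] by simp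
    qed
  qed
  finally have "2 * (\<Sum>e\<in>E. T e) \<le> (\<Sum>e\<in>E. if i < T e then 2 * i + d + 1 else 2 * T e)" .
  moreover have "2 * (\<Sum>e\<in>E. T e) = 2 * residual_cost i + (\<Sum>e\<in>E. if i < T e then 2 * i else 2 * T e)"
    unfolding residual_cost_def sum_distrib_left sum.distrib[symmetric] by (rule sum.cong) auto
  moreover have "(\<Sum>e\<in>E. if i < T e then 2 * i + d + 1 else 2 * T e)
      = (d + 1) * uncovered i + (\<Sum>e\<in>E. if i < T e then 2 * i else 2 * T e)"
  proof -
    have "(d + 1) * uncovered i = (\<Sum>e\<in>E. if i < T e then d + 1 else 0)"
      unfolding uncovered_def using finE by (simp add: sum.If_cases Int_def)
    then show ?thesis by (simp only: sum.distrib[symmetric]) (rule sum.cong, auto)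
  qed
  ultimately show ?thesis by (simp add: d_def)
qed

text \<open>Inserting the averaging bound into \<open>uncovered_square_le\<close> leaves a common
  factor \<open>uncovered i\<close>, which cancels unless it is zero.\<close>

lemma uncovered_le_new_at:
  assumes "D \<subseteq> V" and "\<And>e. e \<in> E \<Longrightarrow> i < T e \<Longrightarrow> D \<inter> e \<noteq> {}"
  shows "uncovered i \<le> card D * new_at (Suc i)"
proof -
  let ?m = "uncovered i" and ?a = "new_at (Suc i)"
  have "?m * ?m + ?a * ?m \<le> ?a * (2 * residual_cost i)"
    using uncovered_square_le[of i] by (simp add: mult_ac)
  also have "\<dots> \<le> ?a * ((card D + 1) * ?m)"
    using residual_cost_le[OF assms] by (rule mult_le_mono2)
  finally have "?m * ?m \<le> card D * ?a * ?m" by (simp add: algebra_simps)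
  then show ?thesis by (cases "?m = 0") auto
qed

section \<open>Geometric decay and the last covering time\<close>

lemma new_at_pos:
  assumes "E \<noteq> {}" "1 \<le> j" "j \<le> last_time"
  shows "1 \<le> new_at j"
proof -
  have "last_time \<in> T ` E" unfolding last_time_def using assms finE by (intro Max_in) auto
  then have "{e \<in> E. T e = last_time} \<noteq> {}" by auto
  then have "1 \<le> new_at last_time" using finE by (simp add: new_at_def Suc_le_eq card_gt_0_iff)
  then show ?thesis using new_at_antimono[OF assms(2,3)] by simp
qed

text \<open>By monotonicity of \<open>new_at\<close>, each time after \<open>k\<close> up to
  \<open>last_time\<close> meets at least one new hyperedge.\<close>

lemma last_time_le_uncovered:
  assumes "E \<noteq> {}" "k \<le> last_time"
  shows "last_time - k \<le> uncovered k"
  using assms(2)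
proof (induction k rule: inc_induct)
  case (step k)
  then show ?case using uncovered_rec[of k] new_at_pos[OF assms(1), of "Suc k"] by simp
qed simp

text \<open>Each step leaves at most the fraction \<open>1 - 1 / card D\<close> uncovered, and this
  is at most \<open>exp (- 1 / card D)\<close>.\<close>

lemma last_time_le:
  assumes ne: "E \<noteq> {}" and D: "D \<subseteq> V" "1 \<le> card D"
    and cov: "\<And>e. e \<in> E \<Longrightarrow> k < T e \<Longrightarrow> D \<inter> e \<noteq> {}" and k: "k < last_time"
  shows "real (last_time - k) - 1 \<le> real (card D) * ln (real (uncovered k))"
proof -
  let ?d = "real (card D)"
  have decay: "real (uncovered (k + n)) \<le> real (uncovered k) * exp (- real n / ?d)" for n
  proof (induction n)
    case (Suc n)
    have "uncovered (k + n) \<le> card D * new_at (Suc (k + n))"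
      using D(1) cov by (intro uncovered_le_new_at) auto
    then have "real (uncovered (k + n)) \<le> ?d * real (new_at (Suc (k + n)))"
      by (metis of_nat_le_iff of_nat_mult)
    then have "real (uncovered (k + n)) / ?d \<le> real (new_at (Suc (k + n)))"
      using D(2) by (simp add: field_simps)
    then have "real (uncovered (k + Suc n)) \<le> real (uncovered (k + n)) * (1 + (- 1 / ?d))"
      using uncovered_rec[of "k + n"] by (simp only: distrib_left) simp
    also have "\<dots> \<le> real (uncovered (k + n)) * exp (- 1 / ?d)"
      by (intro mult_left_mono exp_ge_add_one_self) simp
    also have "\<dots> \<le> real (uncovered k) * exp (- real n / ?d) * exp (- 1 / ?d)"
      using Suc.IH by (intro mult_right_mono) auto
    also have "\<dots> = real (uncovered k) * exp (- real (Suc n) / ?d)"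
      by (simp add: exp_add[symmetric] add_divide_distrib[symmetric] diff_divide_distrib)
    finally show ?case .
  qed simp
  \<comment> \<open>One step before the end some hyperedge is still uncovered; stopping there costs
    the 1 subtracted in the conclusion.\<close>
  define n where "n = last_time - k - 1"
  have "1 \<le> uncovered (k + n)"
    using last_time_le_uncovered[OF ne, of "k + n"] k by (simp add: n_def)
  then have one: "1 \<le> real (uncovered k) * exp (- real n / ?d)"
    using decay[of n] by linarith
  then have pos: "0 < real (uncovered k)"
    by (metis gr0I of_nat_0 of_nat_0_less_iff mult_zero_left not_one_le_zero)
  have "0 \<le> ln (real (uncovered k) * exp (- real n / ?d))" using one by (rule ln_ge_zero)
  also have "\<dots> = ln (real (uncovered k)) - real n / ?d" using pos by (simp add: ln_mult)
  finally have "real n \<le> ?d * ln (real (uncovered k))" using D(2) by (simp add: field_simps)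
  then show ?thesis using k by (simp add: n_def of_nat_diff)
qed

text \<open>Passing from \<open>ln\<close> to \<open>log 2\<close> gains a factor that absorbs the
  lost 1 once at least four steps remain; shorter runs are checked directly. With only two uncovered
  hyperedges equality can occur.\<close>

lemma last_time_less_log:
  assumes ne: "E \<noteq> {}" and D: "D \<subseteq> V" "2 \<le> card D"
    and cov: "\<And>e. e \<in> E \<Longrightarrow> k < T e \<Longrightarrow> D \<inter> e \<noteq> {}" and k: "k < last_time"
    and m: "3 \<le> uncovered k"
  shows "real (last_time - k) < real (card D) * log 2 (real (uncovered k))"
proof (cases "last_time - k \<le> 3")
  case True
  \<comment> \<open>The case of at most three steps rests on \<open>8 < 9\<close>, that is,
    \<open>3 < 2 * log 2 3\<close>.\<close>
  have "3 = log 2 (8::real)" using log_pow_cancel[of "2::real" 3] by simp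
  also have "\<dots> < log 2 9" by simp
  also have "\<dots> = 2 * log 2 (3::real)" using log_nat_power[of 3 2 2] by simp
  also have "\<dots> \<le> real (card D) * log 2 (real (uncovered k))"
    using D m by (intro mult_mono) auto
  finally show ?thesis using True by linarith
next
  case False
  let ?n = "real (last_time - k)"
  \<comment> \<open>The constant 3/4 suits four steps: \<open>n * (3/4) \<le> n - 1\<close> holds
    exactly from \<open>n = 4\<close> on.\<close>
  have "2 < exp (3/4 :: real)" using exp_lower_Taylor_quadratic[of "3/4 :: real"] by (simp add: power2_eq_square)
  then have "ln 2 < ln (exp (3/4 :: real))" by (subst ln_less_cancel_iff) auto
  then have l: "0 < ln (2::real)" "ln (2::real) < 3/4" by simp_all
  have "4 \<le> ?n" using False by linarith
  then have "?n * ln 2 < ?n * (3/4)" using l by (intro mult_strict_left_mono) auto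
  also have "\<dots> \<le> ?n - 1" using \<open>4 \<le> ?n\<close> by simp
  also have "\<dots> \<le> real (card D) * ln (real (uncovered k))"
    using D by (intro last_time_le ne cov k) auto
  finally show ?thesis using l by (simp add: log_def field_simps)
qed

lemma last_time_le_log:
  assumes ne: "E \<noteq> {}" and D: "D \<subseteq> V" "2 \<le> card D"
    and cov: "\<And>e. e \<in> E \<Longrightarrow> k < T e \<Longrightarrow> D \<inter> e \<noteq> {}" and k: "k < last_time"
    and m: "2 \<le> uncovered k"
  shows "real (last_time - k) \<le> real (card D) * log 2 (real (uncovered k))"
proof (cases "uncovered k = 2")
  case True
  then show ?thesis using last_time_le_uncovered[OF ne, of k] k D by simp
next
  case False
  then show ?thesis using last_time_less_log[OF ne D cov k] m by simp
qed

text \<open>The ordering maps the induced cover bijectively onto the initial segment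
  \<open>{1..last_time}\<close>.\<close>

lemma card_induced_cover:
  assumes "E \<noteq> {}"
  shows "card (induced_cover V E \<sigma>) = last_time"
proof -
  have "last_time \<in> T ` E" unfolding last_time_def using assms finE by (intro Max_in) auto
  then have le: "last_time \<le> card V" using cover_time_bounds by auto
  have "\<sigma> ` induced_cover V E \<sigma> = {1..last_time}"
  proof -
    have "\<sigma> ` induced_cover V E \<sigma> = {j \<in> \<sigma> ` V. j \<le> last_time}"
      by (auto simp: induced_cover_def last_time_def)
    then show ?thesis using bij le by (auto simp: bij_betw_def)
  qed
  moreover have "inj_on \<sigma> (induced_cover V E \<sigma>)"
    using bij by (auto simp: bij_betw_def induced_cover_def intro: inj_on_subset)
  ultimately show ?thesis by (metis card_atLeastAtMost card_image diff_Suc_1)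
qed

lemma uncovered_0: "uncovered 0 = card E"
proof -
  have "{e \<in> E. 0 < T e} = E" using cover_time_bounds(1) by force
  then show ?thesis by (simp add: uncovered_def)
qed

lemma last_time_pos: "E \<noteq> {} \<Longrightarrow> 0 < last_time"
proof -
  assume "E \<noteq> {}"
  then obtain e where e: "e \<in> E" by auto
  have "1 \<le> T e" using cover_time_bounds(1)[OF e] .
  also have "\<dots> \<le> last_time" unfolding last_time_def using e finE by (intro Max_ge) auto
  finally show ?thesis by simp
qed

section \<open>Graphs\<close>

text \<open>Uncovered edges at a vertex outside the cover \<open>C\<close> lead to distinct unvisited vertices of \<open>C\<close>.\<close>

lemma new_at_le_outside:
  assumes two: "\<And>e. e \<in> E \<Longrightarrow> card e = 2" and C: "set_cover V E C"
    and w: "w \<in> V" "w \<notin> C" "\<sigma> w = Suc j"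
  shows "new_at (Suc j) \<le> card {v \<in> C. j < \<sigma> v}"
proof -
  let ?A = "{e \<in> E. T e = Suc j}" and ?R = "{v \<in> C. j < \<sigma> v}"
  have finR: "finite ?R" using C finV finite_subset[of ?R V] by (auto simp: set_cover_def)
  have "?A \<subseteq> (\<lambda>x. {w, x}) ` ?R"
  proof
    fix e assume "e \<in> ?A"
    then have e: "e \<in> E" "T e = Suc j" by auto
    obtain v where v: "v \<in> e" "v \<in> V" "\<sigma> v = T e" using e(1) by (rule cover_time_attained)
    then have "v = w" using w e \<sigma>_inj by simp
    obtain x where x: "x \<in> C" "x \<in> e" using C e(1) by (auto simp: set_cover_def)
    have "x \<noteq> w" using x w by auto
    obtain y z where "e = {y, z}" using two[OF e(1)] by (auto simp: card_2_iff)
    then have "e = {w, x}" using \<open>x \<noteq> w\<close> x v \<open>v = w\<close> by auto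
    moreover have "j < \<sigma> x" using cover_time_le[OF e(1) x(2), of \<sigma>] e(2) by simp
    ultimately show "e \<in> (\<lambda>x. {w, x}) ` ?R" using x by auto
  qed
  then have "card ?A \<le> card ((\<lambda>x. {w, x}) ` ?R)" using finR by (intro card_mono) auto
  also have "\<dots> \<le> card ?R" using finR by (rule card_image_le)
  finally show ?thesis by (simp add: new_at_def)
qed

lemma graph_last_time_le:
  assumes two: "\<And>e. e \<in> E \<Longrightarrow> card e = 2" and C: "set_cover V E C" "2 \<le> card C" and ne: "E \<noteq> {}"
  shows "real last_time \<le> 2 * real (card C) * log 2 (real (card C))"
proof -
  define D where "D j = {v \<in> C. j < \<sigma> v}" for j
  have CV: "C \<subseteq> V" using C by (simp add: set_cover_def)
  then have finC: "finite C" using finV finite_subset by blast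
  have "{e \<in> E. T e = Suc (card V)} = {}" using cover_time_bounds(2) by fastforce
  then have "new_at (Suc (card V)) = 0" unfolding new_at_def by (metis card.empty)
  \<comment> \<open>Once all vertices are visited nothing new is met, so the least index
    \<open>k\<close> below exists.\<close>
  then have ex: "new_at (Suc (card V)) \<le> card (D (card V))" by simp
  define k where "k = (LEAST j. new_at (Suc j) \<le> card (D j))"
  have k: "new_at (Suc k) \<le> card (D k)" unfolding k_def using ex by (rule LeastI)
  \<comment> \<open>Before time \<open>k\<close> each step meets more new edges than an outside
    vertex could, so it visits a vertex of \<open>C\<close>.\<close>
  have count: "card (D j) + j = card C" if "j \<le> k" for j
    using that
  proof (induction j)
    case 0
    have "D 0 = C" using \<sigma>_pos CV by (force simp: D_def)
    then show ?case by simp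
  next
    case (Suc j)
    then have gt: "card (D j) < new_at (Suc j)"
      using not_less_Least[of j "\<lambda>j. new_at (Suc j) \<le> card (D j)"] k_def by simp
    then have "{e \<in> E. T e = Suc j} \<noteq> {}" unfolding new_at_def by (metis card.empty not_less_zero)
    then obtain e where "e \<in> E" "T e = Suc j" by blast
    then obtain w where w: "w \<in> V" "\<sigma> w = Suc j" using cover_time_attained[of e] by metis
    then have wC: "w \<in> C" using new_at_le_outside[OF two C(1), of w j] gt by (auto simp: D_def)
    have uniq: "v = w" if "v \<in> C" "\<sigma> v = Suc j" for v
      using that w CV \<sigma>_inj by auto
    have "v \<in> D j \<longleftrightarrow> v \<in> insert w (D (Suc j))" for v
    proof (cases "v = w")
      case True
      then show ?thesis using wC w by (simp add: D_def)
    next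
      case False
      then have "v \<in> C \<Longrightarrow> j < \<sigma> v \<longleftrightarrow> Suc j < \<sigma> v" using uniq[of v] by linarith
      then show ?thesis using False by (auto simp: D_def)
    qed
    then have "D j = insert w (D (Suc j))" by blast
    moreover have "w \<notin> D (Suc j)" using w by (simp add: D_def)
    moreover have "finite (D (Suc j))" using finC by (simp add: D_def)
    ultimately show ?case using Suc by simp
  qed
  let ?t = "card C"
  define u where "u = card (D k)"
  have t: "u + k = ?t" using count[of k] by (simp add: u_def)
  have DV: "D k \<subseteq> V" using CV by (auto simp: D_def)
  have cov: "D k \<inter> e \<noteq> {}" if e: "e \<in> E" "k < T e" for e
  proof -
    obtain v where v: "v \<in> C" "v \<in> e" using C(1) e(1) unfolding set_cover_def by blast
    then have "v \<in> D k" using cover_time_le[OF e(1) v(2), of \<sigma>] e(2) by (simp add: D_def)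
    then show ?thesis using v by auto
  qed
  have "uncovered k \<le> u * new_at (Suc k)"
    unfolding u_def by (rule uncovered_le_new_at[OF DV cov])
  also have "\<dots> \<le> u * u" using k by (simp add: u_def)
  finally have sq: "uncovered k \<le> u * u" .
  have lt: "1 \<le> log 2 (real ?t)" using C(2) by simp
  show ?thesis
  \<comment> \<open>If \<open>u < 2\<close>, at most \<open>u * u \<le> u\<close> edges remain and
    the ordering is done by time \<open>k + u = card C\<close>. Otherwise at least two edges remain
    and the logarithmic bound applies.\<close>
  proof (cases "last_time \<le> k + u \<or> u < 2")
    case True
    have "last_time \<le> k + u"
    proof (cases "last_time \<le> k + u")
      case False
      then have "u * u \<le> u" using True by (cases "u = 0") auto
      then show ?thesis using sq last_time_le_uncovered[OF ne, of k] False by linarith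
    qed
    then have "real last_time \<le> real ?t" using t by simp
    also have "\<dots> \<le> (2 * real ?t) * 1" by simp
    also have "\<dots> \<le> 2 * real ?t * log 2 (real ?t)" using lt by (intro mult_left_mono) auto
    finally show ?thesis .
  next
    case False
    then have kl: "k < last_time" and u: "2 \<le> u" and "u < last_time - k" by auto
    then have m: "2 \<le> uncovered k" using last_time_le_uncovered[OF ne, of k] by linarith
    have "real (last_time - k) \<le> real u * log 2 (real (uncovered k))"
      unfolding u_def using u kl m by (intro last_time_le_log ne DV cov) (auto simp: u_def)
    \<comment> \<open>The factor 2 of the graph bound comes from the exponent in
      \<open>uncovered k \<le> u ^ 2\<close>.\<close>
    also have "\<dots> \<le> real u * log 2 (real u ^ 2)"
      using sq m u by (intro mult_left_mono) (auto simp: power2_eq_square simp flip: of_nat_mult)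
    also have "\<dots> = 2 * real u * log 2 (real u)" using u by (simp add: log_nat_power)
    also have "\<dots> \<le> 2 * real u * log 2 (real ?t)"
      using u t by (intro mult_left_mono) auto
    finally have "real last_time \<le> real k + 2 * real u * log 2 (real ?t)" using kl by simp
    also have "\<dots> \<le> 2 * real k * log 2 (real ?t) + 2 * real u * log 2 (real ?t)"
    proof -
      have "real k * 1 \<le> (2 * real k) * log 2 (real ?t)" using lt by (intro mult_mono) auto
      then show ?thesis by simp
    qed
    also have "\<dots> = 2 * real ?t * log 2 (real ?t)" by (simp flip: t add: algebra_simps)
    finally show ?thesis .
  qed
qed

end

section \<open>Transfer to the maximum over all optimal orderings\<close>

text \<open>The maximum ranges over a nonempty set of numbers bounded by \<open>card V\<close>, so a
  bound proved for an arbitrary optimal ordering carries over.\<close>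

lemma mssc_number_attained:
  assumes "hypergraph V E" "E \<noteq> {}"
  obtains \<sigma> where "optimal_ordering V E \<sigma>" "mssc_number V E = optimal_ordering.last_time E \<sigma>"
proof -
  let ?S = "{card (induced_cover V E \<sigma>) |\<sigma>. min_sum_set_cover V E \<sigma>}"
  have "finite V" using assms by (simp add: hypergraph_def)
  then have "?S \<subseteq> {..card V}" by (auto simp: induced_cover_def intro!: card_mono)
  then have "finite ?S" using finite_subset by blast
  moreover have "?S \<noteq> {}" using min_sum_set_cover_exists[OF assms(1)] by blast
  ultimately have "mssc_number V E \<in> ?S" unfolding mssc_number_def by (rule Max_in)
  then obtain \<sigma> where \<sigma>: "min_sum_set_cover V E \<sigma>" "mssc_number V E = card (induced_cover V E \<sigma>)"
    by auto
  interpret optimal_ordering V E \<sigma> using assms \<sigma> by unfold_locales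
  show ?thesis using that \<sigma> card_induced_cover[OF assms(2)] optimal_ordering_axioms by simp
qed

lemma mssc_number_graph_le:
  assumes "simple_graph V E" "2 \<le> cover_number V E"
  shows "real (mssc_number V E) \<le> 2 * real (cover_number V E) * log 2 (real (cover_number V E))"
proof -
  have hyp: "hypergraph V E" and two: "\<And>e. e \<in> E \<Longrightarrow> card e = 2"
    using assms(1) by (auto simp: simple_graph_def)
  have ne: "E \<noteq> {}" using cover_number_le_card[OF hyp] assms(2) by auto
  obtain C where C: "set_cover V E C" "card C = cover_number V E"
    using hyp by (rule min_cover_exists)
  obtain \<sigma> where \<sigma>: "optimal_ordering V E \<sigma>" "mssc_number V E = optimal_ordering.last_time E \<sigma>"
    using mssc_number_attained[OF hyp ne] .
  show ?thesis
    using optimal_ordering.graph_last_time_le[OF \<sigma>(1) two C(1) _ ne] C(2) \<sigma>(2) assms(2) by simp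
qed

text \<open>The logarithmic bounds are applied from time 0 with a minimum cover as \<open>D\<close>.
  Since \<open>2 \<le> card E\<close>, excluding \<open>card E = 2\<close> supplies the three
  hyperedges needed for strictness; \<open>two_disjoint_hyperedges\<close> shows equality at
  two.\<close>

lemma mssc_number_hypergraph:
  assumes hyp: "hypergraph V E" and two: "2 \<le> cover_number V E"
  shows "real (mssc_number V E) \<le> real (cover_number V E) * log 2 (real (card E))" (is ?le)
    and "card E \<noteq> 2 \<Longrightarrow>
      real (mssc_number V E) < real (cover_number V E) * log 2 (real (card E))" (is "_ \<Longrightarrow> ?less")
proof -
  have m: "2 \<le> card E" using cover_number_le_card[OF hyp] two by simp
  then have ne: "E \<noteq> {}" by auto
  obtain C where C: "set_cover V E C" "card C = cover_number V E"
    using hyp by (rule min_cover_exists)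
  then have CV: "C \<subseteq> V" and cov: "\<And>e. e \<in> E \<Longrightarrow> C \<inter> e \<noteq> {}" by (auto simp: set_cover_def)
  obtain \<sigma> where \<sigma>: "optimal_ordering V E \<sigma>" "mssc_number V E = optimal_ordering.last_time E \<sigma>"
    using mssc_number_attained[OF hyp ne] .
  interpret optimal_ordering V E \<sigma> by (rule \<sigma>(1))
  show ?le
    using last_time_le_log[OF ne CV, of 0] cov last_time_pos[OF ne] m two C \<sigma>(2)
    by (simp add: uncovered_0)
  show ?less if "card E \<noteq> 2"
    using last_time_less_log[OF ne CV, of 0] cov last_time_pos[OF ne] m two C \<sigma>(2) that
    by (simp add: uncovered_0)
qed

lemma log_card_le_hrank:
  assumes "hypergraph V E" "E \<noteq> {}"
  shows "log 2 (real (card E)) \<le> real (hrank E) * log 2 (real (card V))"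
proof -
  have "V \<noteq> {}" using assms by (auto simp: hypergraph_def)
  then have V: "0 < card V" using assms by (simp add: hypergraph_def card_gt_0_iff)
  have E: "0 < card E" using assms hypergraph_finite by (auto simp: card_gt_0_iff)
  have "real (card E) \<le> real (card V) ^ hrank E"
    using card_le_power_hrank[OF assms(1)] by (metis of_nat_le_iff of_nat_power)
  then have "log 2 (real (card E)) \<le> log 2 (real (card V) ^ hrank E)"
    using V E by simp
  then show ?thesis using V by (simp add: log_nat_power)
qed

theorem theorem1:
  fixes VH :: "'a set" and EH :: "'a set set"
    and VG :: "'b set" and EG :: "'b set set"
  assumes "hypergraph VH EH" and "simple_graph VG EG"
  shows
    "(cover_number VG EG \<ge> 2 \<longrightarrow>
        real (mssc_number VG EG)
          \<le> 2 * real (cover_number VG EG) * log 2 (real (cover_number VG EG)))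
     \<and>
     (cover_number VH EH \<ge> 2 \<longrightarrow>
        real (mssc_number VH EH) \<le> real (cover_number VH EH) * log 2 (real (card EH))
        \<and> (card EH \<noteq> 2 \<longrightarrow>
            real (mssc_number VH EH) < real (cover_number VH EH) * log 2 (real (card EH)))
        \<and> real (cover_number VH EH) * log 2 (real (card EH))
            \<le> real (hrank EH) * real (cover_number VH EH) * log 2 (real (card VH)))"
proof (intro conjI impI)
  show "real (mssc_number VG EG) \<le> 2 * real (cover_number VG EG) * log 2 (real (cover_number VG EG))"
    if "2 \<le> cover_number VG EG"
    using mssc_number_graph_le[OF assms(2) that] .
next
  assume two: "2 \<le> cover_number VH EH"
  show "real (mssc_number VH EH) \<le> real (cover_number VH EH) * log 2 (real (card EH))"
    by (rule mssc_number_hypergraph(1)[OF assms(1) two])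
  show "real (mssc_number VH EH) < real (cover_number VH EH) * log 2 (real (card EH))"
    if "card EH \<noteq> 2"
    by (rule mssc_number_hypergraph(2)[OF assms(1) two that])
  have "EH \<noteq> {}" using cover_number_le_card[OF assms(1)] two by auto
  from mult_left_mono[OF log_card_le_hrank[OF assms(1) this], of "real (cover_number VH EH)"]
  show "real (cover_number VH EH) * log 2 (real (card EH))
      \<le> real (hrank EH) * real (cover_number VH EH) * log 2 (real (card VH))"
    by (simp add: mult_ac)
qed

end
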